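(* For every integer $n\geq 1$, the Lusternik-Schnirelmann category of the symplectic group $Sp(n)$ satisfies $$\mathrm{cat}\, Sp(n)\leq \binom{n+1}{2}.$$
   Context: $Sp(n)=\{A\in \mathcal{M}_{n\times n}(\mathbb{H})\colon AA^*=I\}$ is the compact symplectic (quaternionic unitary) group, where $\mathbb{H}$ denotes the quaternions and $A^*$ the conjugate transpose of $A$. The Lusternik-Schnirelmann category $\mathrm{cat}\, G$ of a space $G$ is the (normalized) invariant defined as the least integer $k\geq 0$ such that $G$ admits a covering by $k+1$ open subsets each of which is contractible in $G$, i.e. the inclusion of the subset into $G$ is homotopic to a constant map. In particular a contractible space has category $0$. *)

theory Defs
  imports "HOL-Analysis.Analysis" "HOL-Library.Extended_Nat"
begin

text \<open>\<open>Quat a b c d\<close> is the quaternion $a + bi + cj + dk$.\<close>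

datatype quat = Quat (qRe: real) (qI: real) (qJ: real) (qK: real)

lemma quat_eq_iff:
  "x = y \<longleftrightarrow> qRe x = qRe y \<and> qI x = qI y \<and> qJ x = qJ y \<and> qK x = qK y"
  by (auto intro: quat.expand)

definition qcnj :: "quat \<Rightarrow> quat" where
  "qcnj x = Quat (qRe x) (- qI x) (- qJ x) (- qK x)"

lemma qcnj_sel [simp]:
  "qRe (qcnj x) = qRe x" "qI (qcnj x) = - qI x" "qJ (qcnj x) = - qJ x" "qK (qcnj x) = - qK x"
  by (simp_all add: qcnj_def)

instantiation quat :: ring_1
begin

definition "0 = Quat 0 0 0 0"
definition "1 = Quat 1 0 0 0"
definition "x + y = Quat (qRe x + qRe y) (qI x + qI y) (qJ x + qJ y) (qK x + qK y)"
definition "x - y = Quat (qRe x - qRe y) (qI x - qI y) (qJ x - qJ y) (qK x - qK y)"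
definition "- x = Quat (- qRe x) (- qI x) (- qJ x) (- qK x)"

text \<open>Hamilton's product: $i^2 = j^2 = k^2 = ijk = -1$.\<close>

definition "x * y = Quat
  (qRe x * qRe y - qI x * qI y - qJ x * qJ y - qK x * qK y)
  (qRe x * qI y + qI x * qRe y + qJ x * qK y - qK x * qJ y)
  (qRe x * qJ y - qI x * qK y + qJ x * qRe y + qK x * qI y)
  (qRe x * qK y + qI x * qJ y - qJ x * qI y + qK x * qRe y)"

lemma zero_quat_sel [simp]:
  "qRe 0 = 0" "qI 0 = 0" "qJ 0 = 0" "qK 0 = 0"
  by (simp_all add: zero_quat_def)

lemma one_quat_sel [simp]:
  "qRe 1 = 1" "qI 1 = 0" "qJ 1 = 0" "qK 1 = 0"
  by (simp_all add: one_quat_def)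

lemma plus_quat_sel [simp]:
  "qRe (x + y) = qRe x + qRe y" "qI (x + y) = qI x + qI y"
  "qJ (x + y) = qJ x + qJ y" "qK (x + y) = qK x + qK y"
  by (simp_all add: plus_quat_def)

lemma minus_quat_sel [simp]:
  "qRe (x - y) = qRe x - qRe y" "qI (x - y) = qI x - qI y"
  "qJ (x - y) = qJ x - qJ y" "qK (x - y) = qK x - qK y"
  by (simp_all add: minus_quat_def)

lemma uminus_quat_sel [simp]:
  "qRe (- x) = - qRe x" "qI (- x) = - qI x" "qJ (- x) = - qJ x" "qK (- x) = - qK x"
  by (simp_all add: uminus_quat_def)

lemma times_quat_sel:
  "qRe (x * y) = qRe x * qRe y - qI x * qI y - qJ x * qJ y - qK x * qK y"
  "qI (x * y) = qRe x * qI y + qI x * qRe y + qJ x * qK y - qK x * qJ y"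
  "qJ (x * y) = qRe x * qJ y - qI x * qK y + qJ x * qRe y + qK x * qI y"
  "qK (x * y) = qRe x * qK y + qI x * qJ y - qJ x * qI y + qK x * qRe y"
  by (simp_all add: times_quat_def)

instance
  by standard (simp_all add: quat_eq_iff times_quat_sel ring_distribs)

end

instantiation quat :: real_algebra_1
begin

definition "r *\<^sub>R x = Quat (r * qRe x) (r * qI x) (r * qJ x) (r * qK x)" for r :: real and x :: quat

lemma scaleR_quat_sel [simp]:
  "qRe (r *\<^sub>R x) = r * qRe x" "qI (r *\<^sub>R x) = r * qI x"
  "qJ (r *\<^sub>R x) = r * qJ x" "qK (r *\<^sub>R x) = r * qK x"
  by (simp_all add: scaleR_quat_def)

instance
  by standard (simp_all add: quat_eq_iff times_quat_sel ring_distribs)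

end

text \<open>The real inner product and norm are the Euclidean ones of $\mathbb{H} = \mathbb{R}^4$;
  in particular this fixes the usual topology on the quaternions.\<close>

instantiation quat :: real_inner
begin

definition "x \<bullet> y = qRe x * qRe y + qI x * qI y + qJ x * qJ y + qK x * qK y" for x y :: quat
definition "norm x = sqrt (x \<bullet> x)" for x :: quat
definition "sgn x = x /\<^sub>R norm x" for x :: quat
definition "dist x y = norm (x - y)" for x y :: quat
definition [code del]: "(uniformity :: (quat \<times> quat) filter) =
  (INF e\<in>{0<..}. principal {(x, y). dist x y < e})"
definition [code del]: "open U \<longleftrightarrow>
  (\<forall>x\<in>U. eventually (\<lambda>(x', y). x' = x \<longrightarrow> y \<in> U) uniformity)" for U :: "quat set"

instance
proof
  fix x y z :: quat and r :: real and U :: "quat set"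
  show "x \<bullet> y = y \<bullet> x" "(x + y) \<bullet> z = x \<bullet> z + y \<bullet> z" "(r *\<^sub>R x) \<bullet> y = r * (x \<bullet> y)"
    by (simp_all add: inner_quat_def ring_distribs)
  have *: "x \<bullet> x = (qRe x)\<^sup>2 + (qI x)\<^sup>2 + (qJ x)\<^sup>2 + (qK x)\<^sup>2"
    by (simp add: inner_quat_def power2_eq_square)
  show "0 \<le> x \<bullet> x"
    unfolding * by simp
  show "x \<bullet> x = 0 \<longleftrightarrow> x = 0"
    unfolding * by (simp add: quat_eq_iff add_nonneg_eq_0_iff)
  show "dist x y = norm (x - y)"
    by (rule dist_quat_def)
  show "norm x = sqrt (x \<bullet> x)"
    by (rule norm_quat_def)
  show "sgn x = x /\<^sub>R norm x"
    by (rule sgn_quat_def)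
  show "(uniformity :: (quat \<times> quat) filter) =
      (INF e\<in>{0<..}. principal {(x, y). dist x y < e})"
    by (rule uniformity_quat_def)
  show "open U \<longleftrightarrow> (\<forall>x\<in>U. eventually (\<lambda>(x', y). x' = x \<longrightarrow> y \<in> U) uniformity)"
    by (rule open_quat_def)
qed

end

instance quat :: real_normed_algebra_1
proof
  fix x y :: quat and r :: real
  have "(x * y) \<bullet> (x * y) = (x \<bullet> x) * (y \<bullet> y)"
    unfolding inner_quat_def times_quat_sel by algebra
  then show "norm (x * y) \<le> norm x * norm y"
    by (simp add: norm_quat_def real_sqrt_mult)
  show "norm (1 :: quat) = 1"
    by (simp add: norm_quat_def inner_quat_def)
qed

instantiation quat :: euclidean_space
begin

definition "Basis = {Quat 1 0 0 0, Quat 0 1 0 0, Quat 0 0 1 0, Quat 0 0 0 1}"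

instance
proof
  fix u v x :: quat
  show "(Basis :: quat set) \<noteq> {}" "finite (Basis :: quat set)"
    by (simp_all add: Basis_quat_def)
  show "u \<bullet> v = (if u = v then 1 else 0)" if "u \<in> Basis" "v \<in> Basis"
    using that unfolding Basis_quat_def inner_quat_def by (elim insertE emptyE) simp_all
  show "(\<forall>u\<in>Basis. x \<bullet> u = 0) \<longleftrightarrow> x = 0"
    unfolding Basis_quat_def inner_quat_def quat_eq_iff[of x] by simp
qed

end

definition cadjoint :: "quat ^ 'n ^ 'm \<Rightarrow> quat ^ 'm ^ 'n" where
  "cadjoint A = (\<chi> i j. qcnj (A $ j $ i))"

definition Sp :: "(quat ^ 'n ^ 'n) set" where
  "Sp = {A. A ** cadjoint A = mat 1}"

text \<open>An open subset is categorical if its inclusion into the whole space is null-homotopic.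
  The subset itself need not be a contractible space.\<close>

definition categorical_in :: "'a topology \<Rightarrow> 'a set \<Rightarrow> bool" where
  "categorical_in X U \<longleftrightarrow>
     openin X U \<and> (\<exists>a. homotopic_with (\<lambda>_. True) (subtopology X U) X id (\<lambda>_. a))"

text \<open>The category takes the value \<open>\<infinity>\<close> (the infimum of the empty set)
  if there is no finite categorical cover.\<close>

definition ls_category :: "'a topology \<Rightarrow> enat" where
  "ls_category X = Inf {enat k | k. \<exists>U :: nat \<Rightarrow> 'a set.
     (\<forall>i\<le>k. categorical_in X (U i)) \<and> (\<Union>i\<le>k. U i) = topspace X}"

end

theory Submission
  imports Defs
begin

text \<open>
  Write $E_S$ for the diagonal matrix with entry $-1$ at the indices in $S$ and $+1$ elsewhere.
  For each of the $2^n$ sets $S$ the matrices $A \in Sp(n)$ with $A + E_S$ invertible form an open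
  set $\Omega_S$, which the Cayley transform centred at $E_S$ identifies with the real vector space
  of skew-Hermitian matrices; scaling that space contracts $\Omega_S$ to $E_S$ inside $Sp(n)$
  (\<open>cayley_contraction\<close>). The sets $\Omega_S$ cover $Sp(n)$ (\<open>exists_sign_choice\<close>), so it
  remains to group them into only $\binom{n+1}{2} + 1$ categorical sets.

  Give the indices the weights $1, \dots, n$ in some order, and $S$ the sum of the weights of its
  elements; this takes at most $1 + (1 + \dots + n) = \binom{n+1}{2} + 1$ values. These values
  correspond to the critical levels of the height function $A \mapsto \mathrm{Re}\,\mathrm{tr}(DA)$
  with $D$ the diagonal matrix of weights, whose critical points are the $E_S$. The decisive fact
  is combinatorial: for fixed $A$, among the sets $S$ with $A \in \Omega_S$ there is only one of
  minimal weight (\<open>minimal_sign_choice_unique\<close>). Indeed, these sets satisfy the symmetric exchange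
  property of a delta-matroid (\<open>sign_exchange\<close>), and the greedy argument for distinct positive
  weights applies.

  Let $d_S(A)$ be the distance from $A$ to the matrices $B$ with $B + E_S$ singular. For a fixed
  weight $k$, let $V_S$ consist of those $A \in \Omega_S$ for which $d_S(A)$ exceeds $d_T(A)$ for
  every other $T$ of weight $k$. These sets are open, pairwise disjoint, and each is
  null-homotopic in $Sp(n)$; since $Sp(n)$ is path-connected, their disjoint
  union is null-homotopic as well. By uniqueness of
  the minimum, $A$ lies in $V_S$ for the lightest $S$ with $A \in \Omega_S$, as every other $d_T(A)$ of
  the same weight vanishes. Hence the unions, one for each weight, cover $Sp(n)$.
\<close>

section \<open>Quaternionic matrices\<close>

text \<open>The division algebra structure serves twice: inverses normalize an entry of a kernel vector,
  and the absence of zero divisors lets the exchange argument read off vanishing entries.\<close>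

instantiation quat :: real_normed_div_algebra
begin

definition "inverse x = qcnj x /\<^sub>R (x \<bullet> x)" for x :: quat
definition "x div y = x * inverse y" for x y :: quat

lemma quat_mult_qcnj: "x * qcnj x = (x \<bullet> x) *\<^sub>R 1" "qcnj x * x = (x \<bullet> x) *\<^sub>R 1"
  by (simp_all add: quat_eq_iff times_quat_sel inner_quat_def)

instance
proof
  fix x y :: quat
  show "inverse x * x = 1" "x * inverse x = 1" if "x \<noteq> 0"
    using that by (simp_all add: inverse_quat_def quat_mult_qcnj)
  show "x div y = x * inverse y" by (rule divide_quat_def)
  show "inverse (0::quat) = 0" by (simp add: inverse_quat_def)
  have "(x * y) \<bullet> (x * y) = (x \<bullet> x) * (y \<bullet> y)"
    unfolding inner_quat_def times_quat_sel by algebra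
  then show "norm (x * y) = norm x * norm y"
    by (simp add: norm_quat_def real_sqrt_mult)
qed

end

lemma qcnj_simps [simp]:
  "qcnj 0 = 0" "qcnj 1 = 1" "qcnj (x + y) = qcnj x + qcnj y" "qcnj (x - y) = qcnj x - qcnj y"
  "qcnj (- x) = - qcnj x" "qcnj (r *\<^sub>R x) = r *\<^sub>R qcnj x"
  "qcnj (qcnj x) = x" "qcnj (x * y) = qcnj y * qcnj x" "qcnj x = 0 \<longleftrightarrow> x = 0"
  by (auto simp: quat_eq_iff times_quat_sel)

lemma qcnj_sum: "qcnj (sum f A) = (\<Sum>i\<in>A. qcnj (f i))"
  by (induction A rule: infinite_finite_induct) simp_all

lemma inner_quat_mult_left: "(a * x) \<bullet> y = x \<bullet> (qcnj a * y)"
  by (simp add: inner_quat_def times_quat_sel algebra_simps)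

lemma linear_qcnj: "linear qcnj"
  by (simp add: linear_iff)

lemma continuous_on_qcnj: "continuous_on S f \<Longrightarrow> continuous_on S (\<lambda>x. qcnj (f x))"
  by (rule bounded_linear.continuous_on[OF linear_qcnj[unfolded linear_conv_bounded_linear]])

lemma cadjoint_simps [simp]:
  "cadjoint (cadjoint A) = A" "cadjoint (A + B) = cadjoint A + cadjoint B"
  "cadjoint (A - B) = cadjoint A - cadjoint B"
  "cadjoint (r *\<^sub>R A) = r *\<^sub>R cadjoint A" "cadjoint (mat 1) = mat 1"
  by (simp_all add: cadjoint_def vec_eq_iff mat_def)

lemma cadjoint_mult: "cadjoint (A ** B) = cadjoint B ** cadjoint A"
  by (simp add: cadjoint_def vec_eq_iff matrix_matrix_mult_def qcnj_sum)

text \<open>The conjugate transpose is also the adjoint for the real inner product, so real Euclidean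
  norms suffice to express that symplectic matrices are isometries.\<close>

lemma inner_cadjoint: "(A *v x) \<bullet> y = x \<bullet> (cadjoint A *v y)"
proof -
  have "(A *v x) \<bullet> y = (\<Sum>i\<in>UNIV. \<Sum>j\<in>UNIV. x $ j \<bullet> (qcnj (A $ i $ j) * y $ i))"
    by (simp add: inner_vec_def matrix_vector_mult_def inner_sum_left inner_quat_mult_left)
  also have "\<dots> = x \<bullet> (cadjoint A *v y)"
    by (subst sum.swap)
      (simp add: inner_vec_def matrix_vector_mult_def inner_sum_right cadjoint_def)
  finally show ?thesis .
qed

lemma scaleR_matrix_mult:
  fixes A :: "quat ^ 'n ^ 'm" and B :: "quat ^ 'p ^ 'n"
  shows "(r *\<^sub>R A) ** B = r *\<^sub>R (A ** B)" "A ** (r *\<^sub>R B) = r *\<^sub>R (A ** B)"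
  by (simp_all add: vec_eq_iff matrix_matrix_mult_def scaleR_sum_right)

lemma scaleR_matrix_vector:
  fixes A :: "quat ^ 'n ^ 'm"
  shows "(r *\<^sub>R A) *v x = r *\<^sub>R (A *v x)" "A *v (r *\<^sub>R x) = r *\<^sub>R (A *v x)"
  by (simp_all add: vec_eq_iff matrix_vector_mult_def scaleR_sum_right)

lemma matrix_add_mult_distrib:
  fixes A B :: "'a::semiring_1 ^ 'n ^ 'm"
  shows "(A + B) ** C = A ** C + B ** C"
  by (simp add: vec_eq_iff matrix_matrix_mult_def distrib_right sum.distrib)

lemma matrix_diff_mult_distrib:
  fixes A B :: "'a::ring_1 ^ 'n ^ 'm"
  shows "(A - B) ** C = A ** C - B ** C" "D ** (A - B) = D ** A - D ** B"
  by (simp_all add: vec_eq_iff matrix_matrix_mult_def left_diff_distrib right_diff_distrib sum_subtractf)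

text \<open>The entries do not commute, so there is no determinant to test. Rank-nullity for the underlying
  real-linear map turns injectivity into surjectivity, and preimages of the unit vectors are the
  columns of an inverse.\<close>

lemma invertible_iff_kernel:
  fixes A :: "quat ^ 'n ^ 'n"
  shows "invertible A \<longleftrightarrow> (\<forall>v. A *v v = 0 \<longrightarrow> v = 0)"
proof
  assume "invertible A"
  then obtain B where "B ** A = mat 1"
    by (auto simp: invertible_def)
  then show "\<forall>v. A *v v = 0 \<longrightarrow> v = 0"
    by (metis matrix_vector_mul_assoc matrix_vector_mul_lid matrix_vector_mult_0_right)
next
  assume ker: "\<forall>v. A *v v = 0 \<longrightarrow> v = 0"
  then have "inj ((*v) A)"
    by (simp add: linear_injective_0)
  then have "surj ((*v) A)"
    by (simp add: linear_injective_imp_surjective)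
  then have "\<forall>j. \<exists>y. A *v y = axis j 1"
    by (metis surjD)
  then obtain y where y: "\<And>j. A *v y j = axis j 1"
    by metis
  define B where "B = (\<chi> i j. y j $ i)"
  have "(A ** B) $ i $ j = (A *v y j) $ i" for i j
    by (simp add: B_def matrix_matrix_mult_def matrix_vector_mult_def)
  then have AB: "A ** B = mat 1"
    by (simp add: vec_eq_iff y axis_def mat_def)
  then have "A *v ((B ** A) *v x - x) = 0" for x
    by (simp add: matrix_vector_mult_diff_distrib matrix_vector_mul_assoc matrix_mul_assoc)
  then have "(B ** A) *v x = x" for x
    using ker by force
  then have "B ** A = mat 1"
    by (simp add: matrix_eq)
  with AB show "invertible A"
    by (auto simp: invertible_def)
qed

lemma left_inverse_imp_right_inverse:
  fixes A B :: "quat ^ 'n ^ 'n"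
  assumes "B ** A = mat 1"
  shows "A ** B = mat 1"
proof -
  have "invertible A"
    unfolding invertible_iff_kernel
    by (metis assms matrix_vector_mul_assoc matrix_vector_mul_lid matrix_vector_mult_0_right)
  then obtain C where "A ** C = mat 1"
    by (auto simp: invertible_def)
  then show ?thesis
    by (metis assms matrix_mul_assoc matrix_mul_lid matrix_mul_rid)
qed

lemma Sp_iff: "A \<in> Sp \<longleftrightarrow> cadjoint A ** A = mat 1"
  unfolding Sp_def using left_inverse_imp_right_inverse by blast

lemma Sp_mult: "A \<in> Sp \<Longrightarrow> B \<in> Sp \<Longrightarrow> A ** B \<in> Sp"
  unfolding Sp_iff cadjoint_mult by (metis matrix_mul_assoc matrix_mul_lid)

lemma Sp_norm: "A \<in> Sp \<Longrightarrow> norm (A *v x) = norm x"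
  by (simp add: norm_eq_sqrt_inner inner_cadjoint matrix_vector_mul_assoc Sp_iff)

lemma continuous_on_matrix_mult [continuous_intros]:
  fixes f :: "_ \<Rightarrow> quat ^ 'n ^ 'm"
  assumes "continuous_on S f" "continuous_on S g"
  shows "continuous_on S (\<lambda>x. f x ** g x)"
  unfolding matrix_matrix_mult_def
  by (intro continuous_intros continuous_on_sum continuous_on_mult assms)

lemma continuous_on_matrix_vector_mult [continuous_intros]:
  fixes f :: "_ \<Rightarrow> quat ^ 'n ^ 'm"
  assumes "continuous_on S f" "continuous_on S g"
  shows "continuous_on S (\<lambda>x. f x *v g x)"
  unfolding matrix_vector_mult_def
  by (intro continuous_intros continuous_on_sum continuous_on_mult assms)

lemma compact_Sp: "compact (Sp :: (quat ^ 'n ^ 'n) set)"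
proof -
  have "continuous_on UNIV (cadjoint :: quat ^ 'n ^ 'n \<Rightarrow> _)"
    unfolding cadjoint_def
    by (intro continuous_on_vec_lambda continuous_on_qcnj continuous_on_component continuous_on_id)
  then have "closed (Sp :: (quat ^ 'n ^ 'n) set)"
    unfolding Sp_def
    by (intro closed_Collect_eq continuous_on_matrix_mult continuous_on_const continuous_on_id)
  moreover have "norm A = sqrt CARD('n)" if "A \<in> Sp" for A :: "quat ^ 'n ^ 'n"
  proof -
    have "A $ i \<bullet> A $ i = qRe ((A ** cadjoint A) $ i $ i)" for i
    proof -
      have re: "qRe (sum f UNIV) = (\<Sum>j\<in>UNIV. qRe (f j))" for f :: "'n \<Rightarrow> quat"
        using linear_sum[of qRe f] by (simp add: linear_iff)
      show ?thesis
        by (simp add: inner_vec_def matrix_matrix_mult_def cadjoint_def re quat_mult_qcnj)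
    qed
    with that have "A $ i \<bullet> A $ i = 1" for i
      by (simp add: Sp_def mat_def)
    then show ?thesis
      by (simp add: norm_eq_sqrt_inner inner_vec_def[of A])
  qed
  then have "bounded (Sp :: (quat ^ 'n ^ 'n) set)"
    by (auto simp: bounded_iff)
  ultimately show ?thesis
    by (simp add: compact_eq_bounded_closed)
qed

section \<open>Sign matrices\<close>

definition vec_restrict :: "'n set \<Rightarrow> quat ^ 'n \<Rightarrow> quat ^ 'n" where
  "vec_restrict J v = (\<chi> k. if k \<in> J then v $ k else 0)"

definition sign_matrix :: "'n set \<Rightarrow> quat ^ 'n ^ 'n" where
  "sign_matrix S = (\<chi> i j. if i = j then if i \<in> S then - 1 else 1 else 0)"

lemma sign_matrix_vector: "(sign_matrix S *v v) $ i = (if i \<in> S then - v $ i else v $ i)"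
proof -
  have "(sign_matrix S *v v) $ i = (\<Sum>j\<in>UNIV. if j = i then if i \<in> S then - v $ i else v $ i else 0)"
    unfolding sign_matrix_def matrix_vector_mult_def vec_lambda_beta by (rule sum.cong) auto
  then show ?thesis by simp
qed

lemma sign_matrix_mult: "sign_matrix S ** sign_matrix T = sign_matrix ((S - T) \<union> (T - S))"
  by (auto simp: matrix_eq vec_eq_iff sign_matrix_vector matrix_vector_mul_assoc[symmetric])

lemma sign_matrix_empty [simp]: "sign_matrix {} = mat 1"
  by (simp add: sign_matrix_def mat_def vec_eq_iff)

lemma sign_matrix_sq [simp]: "sign_matrix S ** sign_matrix S = mat 1"
  by (simp add: sign_matrix_mult)

lemma sign_matrix_in_Sp: "sign_matrix S \<in> Sp"
proof -
  have "cadjoint (sign_matrix S) = sign_matrix S"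
    by (auto simp: vec_eq_iff cadjoint_def sign_matrix_def)
  then show ?thesis
    by (simp add: Sp_def)
qed

lemma invertible_mult_sign_matrix:
  fixes A :: "quat ^ 'n ^ 'n"
  shows "invertible (A ** sign_matrix S) \<longleftrightarrow> invertible A"
proof -
  have "invertible (sign_matrix S)"
    unfolding invertible_def using sign_matrix_sq by blast
  moreover have "A = (A ** sign_matrix S) ** sign_matrix S"
    by (simp add: matrix_mul_assoc[symmetric])
  ultimately show ?thesis
    by (metis invertible_mult)
qed

text \<open>Right multiplication by $E_S$ moves the centre $E_S$ to the identity, at the price of
  replacing all other choices by their symmetric difference with $S$. It reduces statements about
  a general centre to statements about the identity.\<close>

lemma invertible_add_sign_matrix:
  fixes A :: "quat ^ 'n ^ 'n"
  shows "invertible (A + sign_matrix ((S - T) \<union> (T - S))) \<longleftrightarrow> invertible (A ** sign_matrix S + sign_matrix T)"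
proof -
  have "((S - T) \<union> (T - S) - S) \<union> (S - ((S - T) \<union> (T - S))) = T"
    by blast
  then have "A ** sign_matrix S + sign_matrix T = (A + sign_matrix ((S - T) \<union> (T - S))) ** sign_matrix S"
    by (simp only: matrix_add_mult_distrib sign_matrix_mult)
  then show ?thesis
    by (simp only: invertible_mult_sign_matrix)
qed

text \<open>Over a field, $\det(A + \mathrm{diag}(x_1, \dots, x_n))$ is affine in each $x_i$ with leading
  monomial $x_1 \cdots x_n$, so it cannot vanish at all sign vectors. The kernel argument below is
  the version of this for quaternions: columns of $A$ are added to a sign matrix one at a time,
  and if both signs of the new diagonal entry produced a kernel vector, the difference of the
  two, corrected in the new entry, would be a kernel vector for the previous stage.\<close>

lemma exists_sign_choice:
  fixes A :: "quat ^ 'n ^ 'n"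
  shows "\<exists>S. invertible (A + sign_matrix S)"
proof -
  have "\<exists>S. \<forall>v. A *v vec_restrict J v + sign_matrix S *v v = 0 \<longrightarrow> v = 0" if "finite J" for J
    using that
  proof (induction J)
    case empty
    have "vec_restrict {} v = 0" for v :: "quat ^ 'n"
      by (simp add: vec_restrict_def vec_eq_iff)
    then have "\<forall>v. A *v vec_restrict {} v + sign_matrix {} *v v = 0 \<longrightarrow> v = 0"
      by simp
    then show ?case by blast
  next
    case (insert i J)
    obtain S where "\<forall>v. A *v vec_restrict J v + sign_matrix S *v v = 0 \<longrightarrow> v = 0"
      using insert.IH by (rule exE)
    note S = this[rule_format]
    \<comment> \<open>A kernel vector of the enlarged map must involve column \<open>i\<close>, so it may be
      scaled from the right to have \<open>i\<close>-th entry 1.\<close>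
    have normalized: "\<exists>v. A *v vec_restrict (insert i J) v + sign_matrix T *v v = 0 \<and> v $ i = 1"
      if T: "T - {i} = S - {i}"
        and v: "A *v vec_restrict (insert i J) v + sign_matrix T *v v = 0" "v \<noteq> 0" for T v
    proof -
      have "v $ i \<noteq> 0"
      proof
        assume v0: "v $ i = 0"
        have "k \<in> T \<longleftrightarrow> k \<in> S" if "k \<noteq> i" for k
          using T that by blast
        then have "(sign_matrix T *v v) $ k = (sign_matrix S *v v) $ k" for k
          using v0 by (cases "k = i") (simp_all add: sign_matrix_vector)
        then have "sign_matrix T *v v = sign_matrix S *v v"
          by (simp add: vec_eq_iff)
        moreover have "vec_restrict (insert i J) v = vec_restrict J v"
          using v0 by (simp add: vec_restrict_def vec_eq_iff)
        ultimately have "A *v vec_restrict J v + sign_matrix S *v v = 0"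
          using v(1) by simp
        with v(2) S show False by blast
      qed
      define w where "w = (\<chi> k. v $ k * inverse (v $ i))"
      have "vec_restrict (insert i J) w = (\<chi> k. vec_restrict (insert i J) v $ k * inverse (v $ i))"
        by (simp add: w_def vec_restrict_def vec_eq_iff)
      then have "A *v vec_restrict (insert i J) w + sign_matrix T *v w
          = (\<chi> k. (A *v vec_restrict (insert i J) v + sign_matrix T *v v) $ k * inverse (v $ i))"
        by (simp add: w_def vec_eq_iff matrix_vector_mult_def sum_distrib_right distrib_right mult.assoc)
      also have "\<dots> = 0"
        by (simp add: v vec_eq_iff)
      finally show ?thesis
        using \<open>v $ i \<noteq> 0\<close> by (intro exI[of _ w]) (simp add: w_def)
    qed
    show ?case
    proof (rule ccontr)
      assume none: "\<not> ?case"
      have both: "\<exists>v. A *v vec_restrict (insert i J) v + sign_matrix T *v v = 0 \<and> v $ i = 1"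
        if T: "T - {i} = S - {i}" for T
      proof -
        from none have "\<not> (\<forall>v. A *v vec_restrict (insert i J) v + sign_matrix T *v v = 0 \<longrightarrow> v = 0)"
          by (rule contrapos_nn) (rule exI)
        then obtain v where "A *v vec_restrict (insert i J) v + sign_matrix T *v v = 0" "v \<noteq> 0"
          by blast
        then show ?thesis
          by (rule normalized[OF T])
      qed
      obtain v where v: "A *v vec_restrict (insert i J) v + sign_matrix (S - {i}) *v v = 0" "v $ i = 1"
        using both[of "S - {i}"] by auto
      obtain w where w: "A *v vec_restrict (insert i J) w + sign_matrix (insert i S) *v w = 0" "w $ i = 1"
        using both[of "insert i S"] by auto
      \<comment> \<open>The \<open>i\<close>-th entries of \<open>v\<close> and \<open>w\<close> cancel under \<open>A\<close> but not under the two opposite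
        signs, which leaves twice a unit vector; the sign of 2 compensates for the \<open>i\<close>-th sign
        of \<open>S\<close>.\<close>
      define u where "u = (\<chi> k. if k = i then (if i \<in> S then - 2 else 2) else v $ k - w $ k)"
      have "vec_restrict J u = vec_restrict (insert i J) v - vec_restrict (insert i J) w"
        using \<open>i \<notin> J\<close> v(2) w(2) by (auto simp: u_def vec_restrict_def vec_eq_iff)
      moreover have "sign_matrix S *v u = sign_matrix (S - {i}) *v v - sign_matrix (insert i S) *v w"
        using v(2) w(2) by (auto simp: u_def vec_eq_iff sign_matrix_vector)
      ultimately have "A *v vec_restrict J u + sign_matrix S *v u
          = (A *v vec_restrict (insert i J) v + sign_matrix (S - {i}) *v v)
            - (A *v vec_restrict (insert i J) w + sign_matrix (insert i S) *v w)"
        by (simp add: matrix_vector_mult_diff_distrib)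
      also have "\<dots> = 0"
        by (simp add: v w)
      finally have "u = 0"
        by (rule S)
      then have "u $ i = 0"
        by simp
      then show False
        by (simp add: u_def split: if_splits)
    qed
  qed
  from this[of UNIV] obtain S where
    S: "\<forall>v. A *v vec_restrict UNIV v + sign_matrix S *v v = 0 \<longrightarrow> v = 0"
    by auto
  have "v = 0" if v: "(A + sign_matrix S) *v v = 0" for v
  proof (rule S[rule_format])
    have "vec_restrict UNIV v = v"
      by (simp add: vec_restrict_def vec_eq_iff)
    with v show "A *v vec_restrict UNIV v + sign_matrix S *v v = 0"
      by (simp add: matrix_vector_mult_add_rdistrib)
  qed
  then show ?thesis
    unfolding invertible_iff_kernel by blast
qed

text \<open>
  Let $Y = 2 (M + I)^{-1}$. Since $M$ is symplectic, $Y - I$ is skew-Hermitian: it is the Cayley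
  transform of $M$. A vector $v$ lies in the kernel of $M + E_J$ exactly when $v = Y P_J v$, where
  $P_J$ is the coordinate projection, so $M + E_J$ is invertible exactly when the principal
  submatrix of $Y - I$ on $J$ is. Now row $i$ of the nonsingular submatrix on $G$ has a nonzero
  entry. If it is the diagonal entry, take $j = i$. Otherwise take its column as $j$: a
  skew-Hermitian two-by-two matrix with a zero on the diagonal and nonzero off-diagonal entries is
  nonsingular. The proof is this argument by contradiction.
\<close>

lemma sign_exchange:
  fixes M :: "quat ^ 'n ^ 'n"
  assumes M: "M \<in> Sp" "invertible (M + mat 1)"
    and G: "invertible (M + sign_matrix G)" "i \<in> G"
  shows "\<exists>j\<in>G. invertible (M + sign_matrix {i, j})"
proof (rule ccontr)
  assume none: "\<not> ?thesis"
  obtain Z where Z: "(M + mat 1) ** Z = mat 1" "Z ** (M + mat 1) = mat 1"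
    using M(2) by (auto simp: invertible_def)
  define Y where "Y = 2 *\<^sub>R Z"
  have Y: "(M + mat 1) ** Y = 2 *\<^sub>R mat 1" "Y ** (M + mat 1) = 2 *\<^sub>R mat 1"
    by (simp_all add: Y_def scaleR_matrix_mult Z)
  have kernel: "(M + sign_matrix J) *v v = 0 \<longleftrightarrow> v = Y *v vec_restrict J v" for J v
  proof -
    have "sign_matrix J *v v = v - 2 *\<^sub>R vec_restrict J v"
      by (simp add: vec_eq_iff sign_matrix_vector vec_restrict_def scaleR_2)
    then have "(M + sign_matrix J) *v v = (M + mat 1) *v v - 2 *\<^sub>R vec_restrict J v"
      by (simp add: matrix_vector_mult_add_rdistrib)
    then have "(M + sign_matrix J) *v v = 0 \<longleftrightarrow> (M + mat 1) *v v = 2 *\<^sub>R vec_restrict J v"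
      by (simp only: right_minus_eq)
    also have "\<dots> \<longleftrightarrow> v = Y *v vec_restrict J v"
    proof
      assume "(M + mat 1) *v v = 2 *\<^sub>R vec_restrict J v"
      then have "(Y ** (M + mat 1)) *v v = Y *v (2 *\<^sub>R vec_restrict J v)"
        by (simp add: matrix_vector_mul_assoc[symmetric])
      then show "v = Y *v vec_restrict J v"
        by (simp add: Y scaleR_matrix_vector)
    next
      assume "v = Y *v vec_restrict J v"
      then have "(M + mat 1) *v v = ((M + mat 1) ** Y) *v vec_restrict J v"
        by (simp add: matrix_vector_mul_assoc[symmetric])
      then show "(M + mat 1) *v v = 2 *\<^sub>R vec_restrict J v"
        by (simp add: Y scaleR_matrix_vector)
    qed
    finally show ?thesis .
  qed
  have skew: "Y + cadjoint Y = 2 *\<^sub>R mat 1"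
  proof -
    have MY: "M ** Y = 2 *\<^sub>R mat 1 - Y"
      using Y(1) by (simp add: matrix_add_mult_distrib algebra_simps)
    have "cadjoint (M ** Y) ** (M ** Y) = cadjoint Y ** ((cadjoint M ** M) ** Y)"
      by (simp add: cadjoint_mult matrix_mul_assoc)
    also have "\<dots> = cadjoint Y ** Y"
      using M(1) by (simp add: Sp_iff)
    finally have "2 *\<^sub>R (2 *\<^sub>R mat 1 - Y - cadjoint Y) = 0"
      unfolding MY by (simp add: matrix_diff_mult_distrib scaleR_matrix_mult algebra_simps)
    then have "2 *\<^sub>R mat 1 - Y - cadjoint Y = 0"
      by (simp only: scaleR_eq_0_iff) simp
    then show ?thesis
      by (simp add: diff_diff_eq)
  qed
  have skew_entry: "Y $ k $ l = - qcnj (Y $ l $ k)" if "k \<noteq> l" for k l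
  proof -
    have "(Y + cadjoint Y) $ k $ l = 0"
      using that by (simp add: skew mat_def)
    then show ?thesis
      by (simp add: cadjoint_def eq_neg_iff_add_eq_0)
  qed
  have Yii: "Y $ i $ i = 1"
  proof -
    obtain v where v: "(M + sign_matrix {i}) *v v = 0" "v \<noteq> 0"
      using none G(2) by (force simp: invertible_iff_kernel)
    have vk: "v $ k = Y $ k $ i * v $ i" for k
    proof -
      have "v $ k = (Y *v vec_restrict {i} v) $ k"
        using v kernel by metis
      also have "\<dots> = (\<Sum>j\<in>UNIV. if j = i then Y $ k $ i * v $ i else 0)"
        unfolding matrix_vector_mult_def vec_lambda_beta by (rule sum.cong) (auto simp: vec_restrict_def)
      finally show ?thesis by simp
    qed
    then have "v $ i \<noteq> 0"
      using v(2) by (metis mult_zero_right vec_eq_iff zero_index)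
    with vk[of i] show ?thesis
      by (metis mult_cancel_right2)
  qed
  have Yij: "Y $ j $ i = 0" if j: "j \<in> G" "j \<noteq> i" for j
  proof (rule ccontr)
    assume nz: "Y $ j $ i \<noteq> 0"
    obtain v where v: "(M + sign_matrix {i, j}) *v v = 0" "v \<noteq> 0"
      using none j(1) by (force simp: invertible_iff_kernel)
    have vk: "v $ k = Y $ k $ i * v $ i + Y $ k $ j * v $ j" for k
    proof -
      have "v $ k = (Y *v vec_restrict {i, j} v) $ k"
        using v kernel by metis
      also have "\<dots> = (\<Sum>l\<in>UNIV. (if l = i then Y $ k $ i * v $ i else 0)
          + (if l = j then Y $ k $ j * v $ j else 0))"
        unfolding matrix_vector_mult_def vec_lambda_beta
        using j(2) by (intro sum.cong) (auto simp: vec_restrict_def)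
      finally show ?thesis by (simp add: sum.distrib)
    qed
    have "Y $ i $ j \<noteq> 0"
      using nz skew_entry[of i j] j(2) by simp
    then have "v $ j = 0"
      using vk[of i] Yii by simp
    moreover from this have "v $ i = 0"
      using vk[of j] nz by simp
    ultimately have "v $ k = 0" for k
      using vk[of k] by simp
    with v(2) show False
      by (simp add: vec_eq_iff)
  qed
  \<comment> \<open>Column \<open>i\<close> of \<open>Y\<close> then agrees on \<open>G\<close> with the unit vector, which makes it a kernel
    vector of \<open>M + sign_matrix G\<close>.\<close>
  have "vec_restrict G (Y *v axis i 1) = axis i 1"
    using Yii Yij G(2) 
    by (auto simp: vec_restrict_def vec_eq_iff axis_def matrix_vector_mult_def if_distrib[of "\<lambda>x. _ * x"] cong: if_cong)
  then have "(M + sign_matrix G) *v (Y *v axis i 1) = 0"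
    by (simp add: kernel)
  then have "Y *v axis i 1 = 0"
    using G(1) by (simp add: invertible_iff_kernel)
  moreover have "(Y *v axis i 1) $ i = 1"
    using Yii by (simp add: axis_def matrix_vector_mult_def if_distrib[of "\<lambda>x. _ * x"] cong: if_cong)
  ultimately show False
    by simp
qed

text \<open>Two different sets of minimal weight would differ in some heaviest index $i$, which lies in
  exactly one of them. An exchange removes $i$ from that set and toggles at most one further,
  strictly lighter index, which yields an admissible set of smaller weight. Distinctness of the
  weights makes the second index strictly lighter; positivity covers the case where it is $i$
  itself or is also removed.\<close>

lemma minimal_sign_choice_unique:
  fixes A :: "quat ^ 'n ^ 'n" and w :: "'n \<Rightarrow> nat"
  assumes A: "A \<in> Sp" and w: "inj w" "\<And>i. w i > 0"
    and S: "invertible (A + sign_matrix S)"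
      "\<And>R. invertible (A + sign_matrix R) \<Longrightarrow> sum w S \<le> sum w R"
    and T: "invertible (A + sign_matrix T)" "sum w T = sum w S"
  shows "T = S"
proof (rule ccontr)
  assume "T \<noteq> S"
  \<comment> \<open>If the heaviest index on which two choices differ belongs to the first one,
    an exchange makes the first one lighter.\<close>
  have lighter: "\<exists>R. invertible (A + sign_matrix R) \<and> sum w R < sum w P"
    if P: "invertible (A + sign_matrix P)" and Q: "invertible (A + sign_matrix Q)"
      and i: "i \<in> P" "i \<notin> Q"
      and max: "\<And>j. j \<in> (P - Q) \<union> (Q - P) \<Longrightarrow> w j \<le> w i" for P Q i
  proof -
    define M where "M = A ** sign_matrix P"
    have toggle: "invertible (M + sign_matrix G) \<longleftrightarrow> invertible (A + sign_matrix ((P - G) \<union> (G - P)))" for G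
      by (simp add: M_def invertible_add_sign_matrix)
    define G where "G = (P - Q) \<union> (Q - P)"
    have "M \<in> Sp"
      using A by (simp add: M_def Sp_mult sign_matrix_in_Sp)
    moreover have "invertible (M + mat 1)"
      using P toggle[of "{}"] by simp
    moreover have "invertible (M + sign_matrix G)"
    proof -
      have "(P - G) \<union> (G - P) = Q" by (auto simp: G_def)
      with Q toggle[of G] show ?thesis by simp
    qed
    moreover have "i \<in> G"
      using i by (simp add: G_def)
    ultimately obtain j where j: "j \<in> G" "invertible (M + sign_matrix {i, j})"
      using sign_exchange by blast
    define R where "R = (P - {i, j}) \<union> ({i, j} - P)"
    have "sum w R < sum w P"
    proof (cases "j \<in> P")
      case True
      then have "R \<subseteq> P" "i \<in> P - R"
        using i by (auto simp: R_def)
      then show ?thesis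
        using w(2)[of i] by (intro sum_strict_mono2[of P R i]) auto
    next
      case False
      then have "w j < w i"
        using max[of j] j(1) w(1) i by (metis G_def inj_eq le_neq_implies_less)
      moreover have "R = insert j (P - {i})"
        using False i by (auto simp: R_def)
      then have "sum w R = w j + sum w (P - {i})"
        using False by simp
      moreover have "sum w P = w i + sum w (P - {i})"
        using i by (simp add: sum.remove)
      ultimately show ?thesis by simp
    qed
    moreover have "invertible (A + sign_matrix R)"
      using j(2) toggle[of "{i, j}"] by (simp add: R_def)
    ultimately show ?thesis by blast
  qed
  define D where "D = (S - T) \<union> (T - S)"
  have "finite (w ` D)" "w ` D \<noteq> {}"
    using \<open>T \<noteq> S\<close> by (auto simp: D_def)
  then obtain i where i: "i \<in> D" "\<And>j. j \<in> D \<Longrightarrow> w j \<le> w i"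
    using Max_in[of "w ` D"] Max_ge[of "w ` D"] by fastforce
  show False
  proof (cases "i \<in> S")
    case True
    then obtain R where "invertible (A + sign_matrix R)" "sum w R < sum w S"
      using lighter[of S T i] S(1) T(1) i unfolding D_def by blast
    then show False
      using S(2) by (simp add: leD)
  next
    case False
    then obtain R where "invertible (A + sign_matrix R)" "sum w R < sum w T"
      using lighter[of T S i] S(1) T(1) i unfolding D_def by blast
    then show False
      using S(2) T(2) by (simp add: leD)
  qed
qed

section \<open>Cayley contraction\<close>

text \<open>
  If $M = (I - X)(I + X)^{-1}$ with $X$ skew-Hermitian, scaling $X$ by $1 - s$ and
  eliminating $X$ gives the path
  $((2 - s) M + s I)(s M + (2 - s) I)^{-1}$ from $M$ at $s = 0$ to $I$ at $s = 1$.
  The denominator is invertible because $M$ is an isometry: a kernel vector $v$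
  satisfies $s |v| = (2 - s) |v|$, which leaves only $s = 1$.
\<close>

lemma cayley_denominator_invertible:
  fixes M :: "quat ^ 'n ^ 'n"
  assumes M: "M \<in> Sp" "invertible (M + mat 1)" and s: "0 \<le> s" "s \<le> 1"
  shows "invertible (s *\<^sub>R M + (2 - s) *\<^sub>R mat 1)"
proof (cases "s = 1")
  case True
  with M show ?thesis by simp
next
  case False
  have "v = 0" if v: "(s *\<^sub>R M + (2 - s) *\<^sub>R mat 1) *v v = 0" for v
  proof -
    have "s *\<^sub>R (M *v v) = - ((2 - s) *\<^sub>R v)"
      using v by (simp add: matrix_vector_mult_add_rdistrib scaleR_matrix_vector eq_neg_iff_add_eq_0)
    then have "norm (s *\<^sub>R (M *v v)) = norm ((2 - s) *\<^sub>R v)"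
      by (simp only: norm_minus_cancel)
    then have "s * norm v = (2 - s) * norm v"
      using s by (simp add: Sp_norm M)
    with False show "v = 0"
      by simp
  qed
  then show ?thesis
    unfolding invertible_iff_kernel by blast
qed

text \<open>Numerator and denominator have the same Gram matrix, because
  $(aM + bI)^*(aM + bI) = (a^2 + b^2) I + ab (M + M^*)$ is symmetric in $a$ and $b$.\<close>

lemma cayley_quotient_in_Sp:
  fixes M :: "quat ^ 'n ^ 'n"
  assumes M: "M \<in> Sp" and D: "invertible (a *\<^sub>R M + b *\<^sub>R mat 1)"
    and Y: "Y ** (a *\<^sub>R M + b *\<^sub>R mat 1) = b *\<^sub>R M + a *\<^sub>R mat 1"
  shows "Y \<in> Sp"
proof -
  have gram: "cadjoint (c *\<^sub>R M + d *\<^sub>R mat 1) ** (c *\<^sub>R M + d *\<^sub>R mat 1)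
      = (c * c + d * d) *\<^sub>R mat 1 + (c * d) *\<^sub>R (M + cadjoint M)" for c d
    using M by (simp add: matrix_add_mult_distrib matrix_add_ldistrib scaleR_matrix_mult Sp_iff
        scaleR_add_left scaleR_add_right mult.commute)
  define D where "D = a *\<^sub>R M + b *\<^sub>R mat 1"
  have YD: "cadjoint (Y ** D) ** (Y ** D) = cadjoint D ** D"
    unfolding D_def Y gram by (simp add: mult.commute add.commute)
  obtain D' where D': "D ** D' = mat 1" "D' ** D = mat 1"
    using D by (auto simp: D_def invertible_def)
  have "cadjoint Y ** Y = cadjoint (D ** D') ** (cadjoint Y ** Y) ** (D ** D')"
    by (simp add: D')
  also have "\<dots> = cadjoint D' ** (cadjoint (Y ** D) ** (Y ** D)) ** D'"
    by (simp add: cadjoint_mult matrix_mul_assoc)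
  also have "\<dots> = cadjoint D' ** (cadjoint D ** D) ** D'"
    by (simp only: YD)
  also have "\<dots> = cadjoint (D ** D') ** (D ** D')"
    by (simp add: cadjoint_mult matrix_mul_assoc)
  also have "\<dots> = mat 1"
    by (simp add: D')
  finally show ?thesis
    by (simp add: Sp_iff)
qed

lemma cayley_contraction:
  "homotopic_with_canon (\<lambda>_. True) {A \<in> Sp. invertible (A + sign_matrix S)} (Sp :: (quat ^ 'n ^ 'n) set)
     id (\<lambda>_. sign_matrix S)"
proof -
  define E :: "quat ^ 'n ^ 'n" where "E = sign_matrix S"
  have EE: "E ** E = mat 1" and E_Sp: "E \<in> Sp"
    by (simp_all add: E_def sign_matrix_in_Sp)
  define \<Omega> where "\<Omega> = {A \<in> Sp. invertible (A + E)}"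
  define K where "K = {0..1::real} \<times> \<Omega>"
  define N where "N = (\<lambda>(s, A). (2 - s) *\<^sub>R (A ** E) + s *\<^sub>R mat 1)"
  define D where "D = (\<lambda>(s, A). s *\<^sub>R (A ** E) + (2 - s) *\<^sub>R mat 1)"
  define g where "g p = (THE Y. Y ** D p = N p)" for p
  have D_inv: "invertible (D p)" and AE: "snd p ** E \<in> Sp" if "p \<in> K" for p
  proof -
    obtain s A where p: "p = (s, A)" by (cases p)
    have A: "A \<in> Sp" "invertible (A + E)" and s: "0 \<le> s" "s \<le> 1"
      using that by (auto simp: K_def \<Omega>_def p)
    show "snd p ** E \<in> Sp"
      using A E_Sp by (simp add: p Sp_mult)
    have "invertible (A ** E + sign_matrix {})"
      using invertible_add_sign_matrix[of A S "{}"] A(2) by (simp add: E_def)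
    then have "invertible (A ** E + mat 1)"
      by simp
    then show "invertible (D p)"
      using \<open>snd p ** E \<in> Sp\<close> s by (simp add: D_def p cayley_denominator_invertible)
  qed
  have g_unique: "Y ** D p = N p \<longleftrightarrow> Y = g p" if p: "p \<in> K" for Y p
  proof -
    obtain D' where D': "D p ** D' = mat 1" "D' ** D p = mat 1"
      using D_inv[OF p] by (auto simp: invertible_def)
    have *: "Z ** D p = N p \<longleftrightarrow> Z = N p ** D'" for Z
      by (metis D' matrix_mul_assoc matrix_mul_rid)
    then have "g p = N p ** D'"
      unfolding g_def by simp
    with * show ?thesis by simp
  qed
  have g_Sp: "g p \<in> Sp" if p: "p \<in> K" for p
  proof (rule cayley_quotient_in_Sp[OF AE[OF p]])
    show "invertible (fst p *\<^sub>R (snd p ** E) + (2 - fst p) *\<^sub>R mat 1)"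
      using D_inv[OF p] by (simp add: D_def case_prod_unfold)
    show "g p ** (fst p *\<^sub>R (snd p ** E) + (2 - fst p) *\<^sub>R mat 1)
        = (2 - fst p) *\<^sub>R (snd p ** E) + fst p *\<^sub>R mat 1"
      using g_unique[OF p, of "g p"] by (simp add: D_def N_def case_prod_unfold)
  qed
  have contN: "continuous_on UNIV N" and contD: "continuous_on UNIV D"
    unfolding N_def D_def case_prod_unfold
    by (intro continuous_on_matrix_mult continuous_intros)+
  \<comment> \<open>The graph of \<open>g\<close> is cut out by a polynomial equation and its values lie in a compact set,
    so the graph is closed and \<open>g\<close> is continuous.\<close>
  have "continuous_on K g"
  proof -
    have "closed {q :: (real \<times> (quat ^ 'n ^ 'n)) \<times> (quat ^ 'n ^ 'n). snd q ** D (fst q) = N (fst q)}"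
      by (intro closed_Collect_eq continuous_on_matrix_mult continuous_on_snd continuous_on_id
          continuous_on_compose2[OF contN] continuous_on_compose2[OF contD] continuous_on_fst) auto
    then have "closedin (top_of_set (K \<times> Sp))
        ((K \<times> Sp) \<inter> {q. snd q ** D (fst q) = N (fst q)})"
      by (rule closedin_closed_Int)
    also have "(K \<times> Sp) \<inter> {q. snd q ** D (fst q) = N (fst q)} = (\<lambda>x. (x, g x)) ` K"
      using g_unique g_Sp by auto
    finally show ?thesis
      using continuous_closed_graph_eq[OF compact_Sp, of g K] g_Sp by auto
  qed
  then have "continuous_on K (\<lambda>p. g p ** E)"
    by (intro continuous_on_matrix_mult continuous_on_const)
  moreover have "(\<lambda>p. g p ** E) ` K \<subseteq> Sp"
    using g_Sp E_Sp by (auto intro: Sp_mult)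
  moreover have "g (0, A) ** E = A" if "A \<in> \<Omega>" for A
  proof -
    have "A ** E = g (0, A)"
      using g_unique[of "(0, A)" "A ** E"] that by (simp add: K_def D_def N_def scaleR_matrix_mult)
    then show ?thesis
      by (metis EE matrix_mul_assoc matrix_mul_rid)
  qed
  moreover have "g (1, A) ** E = E" if "A \<in> \<Omega>" for A
  proof -
    have "mat 1 = g (1, A)"
      using g_unique[of "(1, A)" "mat 1"] that by (simp add: K_def D_def N_def)
    then show ?thesis
      by (metis matrix_mul_lid)
  qed
  ultimately have "homotopic_with_canon (\<lambda>_. True) \<Omega> Sp id (\<lambda>_. E)"
    unfolding K_def
    by (subst homotopic_with)
      (auto intro!: exI[of _ "\<lambda>p. g p ** E"])
  then show ?thesis
    by (simp add: \<Omega>_def E_def)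
qed

section \<open>Connectedness\<close>

text \<open>The entries $-1$ are joined to $1$ along the half circle
  $\cos \pi t + i \sin \pi t$ of unit quaternions.\<close>

lemma path_component_Sp_sign_matrix:
  "path_component (Sp :: (quat ^ 'n ^ 'n) set) (mat 1) (sign_matrix S)"
proof -
  define u :: "real \<Rightarrow> quat" where "u t = cos (pi * t) *\<^sub>R 1 + sin (pi * t) *\<^sub>R Quat 0 1 0 0" for t
  define \<gamma> :: "real \<Rightarrow> quat ^ 'n ^ 'n"
    where "\<gamma> t = (\<chi> i j. if i = j then if i \<in> S then u t else 1 else 0)" for t
  have u: "u t * qcnj (u t) = 1" for t
    unfolding quat_mult_qcnj using sin_cos_squared_add[of "pi * t"]
    by (simp add: u_def inner_quat_def power2_eq_square)
  have "continuous_on A (\<lambda>t. if b then if c then u t else 1 else 0)" for A b c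
    unfolding u_def by (cases b; cases c; simp; intro continuous_intros)
  then have "path \<gamma>"
    unfolding path_def \<gamma>_def by (intro continuous_on_vec_lambda)
  moreover have "\<gamma> t \<in> Sp" for t
  proof -
    have "(\<gamma> t ** cadjoint (\<gamma> t)) $ i $ j
        = (\<Sum>k\<in>UNIV. if k = i then if i = j then 1 else 0 else 0)" for i j
      unfolding matrix_matrix_mult_def vec_lambda_beta
      by (rule sum.cong) (auto simp: \<gamma>_def cadjoint_def u)
    then show ?thesis
      by (simp add: Sp_def mat_def vec_eq_iff)
  qed
  moreover have "\<gamma> 0 = mat 1" "\<gamma> 1 = sign_matrix S"
    by (auto simp: \<gamma>_def u_def mat_def sign_matrix_def vec_eq_iff)
  ultimately show ?thesis
    unfolding path_component_def pathstart_def pathfinish_def path_image_def by blast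
qed

lemma path_connected_Sp: "path_connected (Sp :: (quat ^ 'n ^ 'n) set)"
proof -
  have "path_component Sp (mat 1) A" if A: "A \<in> Sp" for A :: "quat ^ 'n ^ 'n"
  proof -
    obtain S where S: "invertible (A + sign_matrix S)"
      using exists_sign_choice by blast
    have "homotopic_with_canon (\<lambda>_. True) {A} Sp id (\<lambda>_. sign_matrix S)"
      using A S by (intro homotopic_with_subset_left[OF cayley_contraction]) auto
    then have "homotopic_with_canon (\<lambda>_. True) {A} Sp (\<lambda>_. A) (\<lambda>_. sign_matrix S)"
      by (rule homotopic_with_eq) auto
    moreover have "top_of_set {A} \<noteq> trivial_topology"
      by (metis insert_not_empty topspace_discrete_topology topspace_euclidean_subtopology)
    ultimately have "path_component Sp A (sign_matrix S)"
      by (simp add: homotopic_constant_maps)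
    then show ?thesis
      using path_component_Sp_sign_matrix path_component_sym path_component_trans by blast
  qed
  then show ?thesis
    unfolding path_connected_component by (meson path_component_sym path_component_trans)
qed

section \<open>The categorical cover\<close>

text \<open>Singularity is witnessed by a kernel vector on the compact unit sphere, so the singular
  matrices are the projection of a closed set along a compact factor.\<close>

lemma closed_singular_shift: "closed {A :: quat ^ 'n ^ 'n. \<not> invertible (A + B)}"
proof -
  have "{A. \<not> invertible (A + B)} = {A. \<exists>v. v \<in> sphere 0 1 \<and> (v, A) \<in> {p. (snd p + B) *v fst p = 0}}"
  proof -
    have "\<exists>u. norm u = 1 \<and> (A + B) *v u = 0" if A: "\<not> invertible (A + B)" for A
    proof -
      obtain v where v: "(A + B) *v v = 0" "v \<noteq> 0"
        using A unfolding invertible_iff_kernel by blast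
      then show ?thesis
        by (intro exI[of _ "sgn v"]) (simp add: norm_sgn sgn_div_norm scaleR_matrix_vector)
    qed
    moreover have "\<not> invertible (A + B)" if "norm u = 1" "(A + B) *v u = 0" for A u
      using that unfolding invertible_iff_kernel by force
    ultimately show ?thesis by auto
  qed
  moreover have "closed {p :: (quat ^ 'n) \<times> (quat ^ 'n ^ 'n). (snd p + B) *v fst p = 0}"
    by (intro closed_Collect_eq continuous_on_matrix_vector_mult continuous_intros)
  ultimately show ?thesis
    by (simp only: closed_compact_projection[OF compact_sphere])
qed

theorem corollary3p7:
  shows "ls_category (top_of_set (Sp :: (quat ^ 'n ^ 'n) set)) \<le> enat ((CARD('n) + 1) choose 2)"
proof -
  obtain w :: "'n \<Rightarrow> nat" where w: "bij_betw w UNIV {1..CARD('n)}"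
    using finite_same_card_bij[of "UNIV :: 'n set" "{1..CARD('n)}"] by auto
  then have inj_w: "inj w" and pos_w: "w i > 0" for i
    using bij_betwE[OF w] by (auto simp: bij_betw_def Suc_le_eq)
  define N where "N = (CARD('n) + 1) choose 2"
  have weight_le: "sum w S \<le> N" for S
  proof -
    have "sum w S \<le> sum w UNIV"
      by (rule sum_mono2) auto
    also have "\<dots> = \<Sum>{1..CARD('n)}"
      using sum.reindex_bij_betw[OF w, of "\<lambda>x. x"] by simp
    also have "\<dots> = N"
      using gauss_sum_from_Suc_0[of "CARD('n)", where ?'a = nat]
      by (simp add: N_def choose_two mult.commute)
    finally show ?thesis .
  qed
  define d where "d S A = infdist A {B. \<not> invertible (B + sign_matrix S)}"
    for S :: "'n set" and A :: "quat ^ 'n ^ 'n"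
  have d_pos: "d S A > 0 \<longleftrightarrow> invertible (A + sign_matrix S)" for S A
  proof -
    have "- sign_matrix S \<in> {B. \<not> invertible (B + sign_matrix S)}"
      by (auto simp: invertible_iff_kernel intro!: exI[of _ "axis undefined 1"])
    then have "{B. \<not> invertible (B + sign_matrix S)} \<noteq> {}"
      by blast
    from in_closed_iff_infdist_zero[OF closed_singular_shift this, of A] show ?thesis
      using infdist_nonneg[of A "{B. \<not> invertible (B + sign_matrix S)}"] by (auto simp: d_def)
  qed
  have cont_d: "continuous_on UNIV (d S)" for S
    unfolding d_def by (intro continuous_intros)
  \<comment> \<open>Comparing the distances makes the sets of equal weight disjoint while keeping them open.
    The condition \<open>0 < d S A\<close> matters when \<open>S\<close> is the only set of its weight.\<close>
  define V where "V S = {A \<in> Sp. 0 < d S A \<and> (\<forall>T. T \<noteq> S \<and> sum w T = sum w S \<longrightarrow> d T A < d S A)}"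
    for S :: "'n set"
  have V_open: "openin (top_of_set Sp) (V S)" for S
  proof -
    have "open ({A. 0 < d S A} \<inter> (\<Inter>T\<in>{T. T \<noteq> S \<and> sum w T = sum w S}. {A. d T A < d S A}))"
      by (intro open_Int open_INT ballI open_Collect_less cont_d continuous_on_const) auto
    moreover have "V S = Sp \<inter> ({A. 0 < d S A} \<inter> (\<Inter>T\<in>{T. T \<noteq> S \<and> sum w T = sum w S}. {A. d T A < d S A}))"
      by (auto simp: V_def)
    ultimately show ?thesis
      by (simp add: openin_open_Int)
  qed
  have V_disjoint: "V S \<inter> V T = {}" if "S \<noteq> T" "sum w S = sum w T" for S T
  proof -
    have "A \<notin> V T" if "A \<in> V S" for A
    proof
      assume "A \<in> V T"
      then have "d S A < d T A"
        using \<open>S \<noteq> T\<close> \<open>sum w S = sum w T\<close> by (simp add: V_def)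
      moreover have "d T A < d S A"
        using \<open>A \<in> V S\<close> \<open>S \<noteq> T\<close> \<open>sum w S = sum w T\<close> by (simp add: V_def)
      ultimately show False
        by simp
    qed
    then show ?thesis
      by blast
  qed
  define U where "U k = \<Union>(V ` {S. sum w S = k})" for k
  have "categorical_in (top_of_set Sp) (U k)" for k
  proof -
    define \<F> where "\<F> = V ` {S. sum w S = k}"
    have U_open: "openin (top_of_set Sp) (U k)"
      unfolding U_def using V_open by blast
    then have "U k \<subseteq> Sp"
      by (rule openin_imp_subset)
    have sub_open: "openin (top_of_set (\<Union>\<F>)) (\<Union>\<G>)" if "\<G> \<subseteq> \<F>" for \<G>
    proof (rule openin_subset_trans)
      show "openin (top_of_set Sp) (\<Union>\<G>)"
        using that V_open unfolding \<F>_def by (intro openin_Union) blast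
    qed (use that \<open>U k \<subseteq> Sp\<close> in \<open>auto simp: \<F>_def U_def\<close>)
    have complement: "\<Union>\<F> - X = \<Union>(\<F> - {X})" if "X \<in> \<F>" for X
    proof -
      have "X \<inter> Y = {}" if Y: "Y \<in> \<F> - {X}" for Y
      proof -
        obtain S T where "X = V S" "Y = V T" "sum w S = k" "sum w T = k"
          using Y \<open>X \<in> \<F>\<close> by (auto simp: \<F>_def)
        with Y V_disjoint[of S T] show ?thesis
          by auto
      qed
      then show ?thesis
        by blast
    qed
    obtain a where "homotopic_with_canon (\<lambda>_. True) (\<Union>\<F>) Sp id (\<lambda>_. a)"
    proof (rule inessential_on_clopen_Union[OF path_connected_Sp])
      fix X assume X: "X \<in> \<F>"
      show "openin (top_of_set (\<Union>\<F>)) X"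
        using sub_open[of "{X}"] X by simp
      show "closedin (top_of_set (\<Union>\<F>)) X"
        unfolding closedin_def using sub_open[of "\<F> - {X}"] X complement[OF X] by auto
      obtain S where "X = V S"
        using X by (auto simp: \<F>_def)
      then have "X \<subseteq> {A \<in> Sp. invertible (A + sign_matrix S)}"
        using d_pos by (auto simp: V_def)
      then show "\<exists>a. homotopic_with_canon (\<lambda>_. True) X Sp id (\<lambda>_. a)"
        using homotopic_with_subset_left[OF cayley_contraction] by blast
    qed
    moreover have "Sp \<inter> U k = \<Union>\<F>"
      using \<open>U k \<subseteq> Sp\<close> by (auto simp: U_def \<F>_def)
    ultimately show ?thesis
      using U_open by (auto simp: categorical_in_def subtopology_subtopology)
  qed
  moreover have "(\<Union>k\<le>N. U k) = topspace (top_of_set Sp)"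
  proof -
    have "A \<in> (\<Union>k\<le>N. U k)" if A: "A \<in> Sp" for A
    proof -
      obtain S where S: "invertible (A + sign_matrix S)"
        and min: "\<And>R. invertible (A + sign_matrix R) \<Longrightarrow> sum w S \<le> sum w R"
        using exists_sign_choice[of A]
          ex_has_least_nat[of "\<lambda>S. invertible (A + sign_matrix S)" _ "sum w"] by blast
      \<comment> \<open>Any other set of the same weight is inadmissible for \<open>A\<close>, hence at distance 0.\<close>
      have "d T A < d S A" if "T \<noteq> S" "sum w T = sum w S" for T
      proof -
        have "\<not> invertible (A + sign_matrix T)"
          using minimal_sign_choice_unique[OF A inj_w pos_w S min _ that(2)] that(1) by blast
        then show ?thesis
          using d_pos[of S A] d_pos[of T A] S by linarith
      qed
      then have "A \<in> V S"
        using A S d_pos by (simp add: V_def)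
      then show ?thesis
        using weight_le by (auto simp: U_def)
    qed
    moreover have "V S \<subseteq> Sp" for S
      by (auto simp: V_def)
    ultimately show ?thesis
      by (auto simp: U_def)
  qed
  ultimately show ?thesis
    unfolding ls_category_def N_def[symmetric] by (intro Inf_lower) blast
qed

end
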